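(* Let $G$ be an AG-group, and let $(G,Par)$ denote the set of all quadruples $(a,b,c,d)\in G^4$ for which $Par(a,b,c,d)$ holds, with the componentwise operation $(a_1,b_1,c_1,d_1)\,@\,(a_2,b_2,c_2,d_2)=(a_1a_2,b_1b_2,c_1c_2,d_1d_2)$. Then $(G,Par)$ under $@$ is again an AG-group.
   Context: An AG-group is a set $G$ with a binary operation (written as juxtaposition, in general neither associative nor commutative) satisfying the left invertive law $(xy)z=(zy)x$ for all $x,y,z\in G$, having a left identity $e$ (so $ex=x$ for all $x\in G$), and such that every $a\in G$ has an inverse $a^{-1}\in G$ with $a^{-1}a=aa^{-1}=e$. For $a,b,c,d\in G$, we say that $a,b,c,d$ form a parallelogram, written $Par(a,b,c,d)$, if there are $p,q\in G$ such that $pa=qb$ and $pd=qc$. The assertion includes that the set of parallelogram quadruples is closed under $@$. *)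

theory Defs
  imports Main
begin

text \<open>
  Only the existence of a left identity and of inverses with respect to it is required;
  neither is part of the data. Left identities are unique by the other axioms.
\<close>

locale AG_group =
  fixes G :: "'a set" and mult :: "'a \<Rightarrow> 'a \<Rightarrow> 'a" (infixl "\<cdot>" 70)
  assumes closed: "\<lbrakk>x \<in> G; y \<in> G\<rbrakk> \<Longrightarrow> x \<cdot> y \<in> G"
    and left_invertive: "\<lbrakk>x \<in> G; y \<in> G; z \<in> G\<rbrakk> \<Longrightarrow> (x \<cdot> y) \<cdot> z = (z \<cdot> y) \<cdot> x"
    and left_identity_and_inverses:
      "\<exists>e\<in>G. (\<forall>x\<in>G. e \<cdot> x = x) \<and> (\<forall>a\<in>G. \<exists>b\<in>G. b \<cdot> a = e \<and> a \<cdot> b = e)"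

definition Par :: "'a set \<Rightarrow> ('a \<Rightarrow> 'a \<Rightarrow> 'a) \<Rightarrow> 'a \<Rightarrow> 'a \<Rightarrow> 'a \<Rightarrow> 'a \<Rightarrow> bool" where
  "Par G mult a b c d \<longleftrightarrow> (\<exists>p\<in>G. \<exists>q\<in>G. mult p a = mult q b \<and> mult p d = mult q c)"

definition Par_quadruples :: "'a set \<Rightarrow> ('a \<Rightarrow> 'a \<Rightarrow> 'a) \<Rightarrow> ('a \<times> 'a \<times> 'a \<times> 'a) set" where
  "Par_quadruples G mult =
     {(a, b, c, d). a \<in> G \<and> b \<in> G \<and> c \<in> G \<and> d \<in> G \<and> Par G mult a b c d}"

fun quad_mult ::
  "('a \<Rightarrow> 'a \<Rightarrow> 'a) \<Rightarrow> 'a \<times> 'a \<times> 'a \<times> 'a \<Rightarrow> 'a \<times> 'a \<times> 'a \<times> 'a \<Rightarrow> 'a \<times> 'a \<times> 'a \<times> 'a" where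
  "quad_mult mult (a1, b1, c1, d1) (a2, b2, c2, d2) =
     (mult a1 a2, mult b1 b2, mult c1 c2, mult d1 d2)"

end

theory Submission
  imports Defs
begin

text \<open>
  Everything rests on the medial law \<open>(ab)(cd) = (ac)(bd)\<close>. Multiplying componentwise the
  witnesses \<open>p, q\<close> of two parallelograms gives witnesses for the product. Inverting them gives
  witnesses for the quadruple of inverses: by mediality \<open>p\<inverse>a\<inverse>\<close> and \<open>q\<inverse>b\<inverse>\<close> are both
  left inverses of \<open>pa = qb\<close>, and left inverses are unique.
\<close>

context AG_group
begin

text \<open>The left invertive law reverses the outer factors of a left-nested product. Reversing
  the whole product, then the inner \<open>(c \<cdot> d) \<cdot> b\<close>, then the whole again
  exchanges \<open>b\<close> and \<open>c\<close>.\<close>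

lemma medial:
  assumes "a \<in> G" "b \<in> G" "c \<in> G" "d \<in> G"
  shows "(a \<cdot> b) \<cdot> (c \<cdot> d) = (a \<cdot> c) \<cdot> (b \<cdot> d)"
proof -
  have "(a \<cdot> b) \<cdot> (c \<cdot> d) = ((c \<cdot> d) \<cdot> b) \<cdot> a"
    using assms by (intro left_invertive closed)
  also have "(c \<cdot> d) \<cdot> b = (b \<cdot> d) \<cdot> c"
    using assms by (intro left_invertive)
  also have "((b \<cdot> d) \<cdot> c) \<cdot> a = (a \<cdot> c) \<cdot> (b \<cdot> d)"
    using assms by (intro left_invertive closed)
  finally show ?thesis .
qed

text \<open>The left invertive law stands in for associativity: if \<open>v \<cdot> u\<close> and
  \<open>z \<cdot> u\<close> both equal \<open>e\<close>, then
  \<open>(v \<cdot> u) \<cdot> z = (z \<cdot> u) \<cdot> v\<close> reduces to \<open>z = v\<close>.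
  Hence \<open>x\<close> and \<open>y\<close> both equal \<open>v\<close>.\<close>

lemma left_inverse_unique:
  assumes e: "\<And>x. x \<in> G \<Longrightarrow> e \<cdot> x = x"
    and G: "x \<in> G" "y \<in> G" "u \<in> G" "v \<in> G"
    and "v \<cdot> u = e" "x \<cdot> u = e" "y \<cdot> u = e"
  shows "x = y"
proof -
  have "z = v" if "z \<in> G" "z \<cdot> u = e" for z
    using left_invertive[of v u z] e that assms by metis
  then show ?thesis
    using assms by metis
qed

lemma inverse_eqI:
  assumes e: "\<And>x. x \<in> G \<Longrightarrow> e \<cdot> x = x" "e \<in> G"
    and G: "p \<in> G" "q \<in> G" "a \<in> G" "b \<in> G" "p' \<in> G" "q' \<in> G" "a' \<in> G" "b' \<in> G"
    and inv: "p' \<cdot> p = e" "q' \<cdot> q = e" "a' \<cdot> a = e" "b' \<cdot> b = e"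
    and eq: "p \<cdot> a = q \<cdot> b"
  shows "p' \<cdot> a' = q' \<cdot> b'"
proof -
  \<comment> \<open>Mediality regroups the products as
    \<open>(p' \<cdot> p) \<cdot> (a' \<cdot> a)\<close> and
    \<open>(q' \<cdot> q) \<cdot> (b' \<cdot> b)\<close>, each of which is
    \<open>e \<cdot> e = e\<close>.\<close>
  have "(p' \<cdot> a') \<cdot> (p \<cdot> a) = e" "(q' \<cdot> b') \<cdot> (q \<cdot> b) = e"
    using medial[of p' a' p a] medial[of q' b' q b] G inv e by simp_all
  then show ?thesis
    using left_inverse_unique[OF e(1)] G closed eq by metis
qed

lemma Par_mult:
  assumes G: "a1 \<in> G" "b1 \<in> G" "c1 \<in> G" "d1 \<in> G" "a2 \<in> G" "b2 \<in> G" "c2 \<in> G" "d2 \<in> G"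
    and "Par G mult a1 b1 c1 d1" "Par G mult a2 b2 c2 d2"
  shows "Par G mult (a1 \<cdot> a2) (b1 \<cdot> b2) (c1 \<cdot> c2) (d1 \<cdot> d2)"
proof -
  obtain p1 q1 p2 q2 where pq: "p1 \<in> G" "q1 \<in> G" "p2 \<in> G" "q2 \<in> G"
    and "p1 \<cdot> a1 = q1 \<cdot> b1" "p1 \<cdot> d1 = q1 \<cdot> c1" "p2 \<cdot> a2 = q2 \<cdot> b2" "p2 \<cdot> d2 = q2 \<cdot> c2"
    using assms unfolding Par_def by blast
  \<comment> \<open>By mediality the left side of the first equation is
    \<open>(p1 \<cdot> a1) \<cdot> (p2 \<cdot> a2)\<close>; the other sides split in the same
    way.\<close>
  then have "(p1 \<cdot> p2) \<cdot> (a1 \<cdot> a2) = (q1 \<cdot> q2) \<cdot> (b1 \<cdot> b2)"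
    "(p1 \<cdot> p2) \<cdot> (d1 \<cdot> d2) = (q1 \<cdot> q2) \<cdot> (c1 \<cdot> c2)"
    using G medial by metis+
  then show ?thesis
    using pq closed unfolding Par_def by blast
qed

lemma Par_inverse:
  assumes e: "\<And>x. x \<in> G \<Longrightarrow> e \<cdot> x = x" "e \<in> G"
    and ex: "\<And>a. a \<in> G \<Longrightarrow> \<exists>b\<in>G. b \<cdot> a = e \<and> a \<cdot> b = e"
    and G: "a \<in> G" "b \<in> G" "c \<in> G" "d \<in> G" "a' \<in> G" "b' \<in> G" "c' \<in> G" "d' \<in> G"
    and inv: "a' \<cdot> a = e" "b' \<cdot> b = e" "c' \<cdot> c = e" "d' \<cdot> d = e"
    and "Par G mult a b c d"
  shows "Par G mult a' b' c' d'"
proof -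
  obtain p q where pq: "p \<in> G" "q \<in> G" "p \<cdot> a = q \<cdot> b" "p \<cdot> d = q \<cdot> c"
    using assms unfolding Par_def by blast
  obtain p' q' where pq': "p' \<in> G" "q' \<in> G" "p' \<cdot> p = e" "q' \<cdot> q = e"
    using ex pq by metis
  have "p' \<cdot> a' = q' \<cdot> b'"
    by (rule inverse_eqI[of e p q a b]) (use e G inv pq pq' in auto)
  \<comment> \<open>In \<open>Par\<close> the vertex \<open>d\<close> is paired with
    \<open>p\<close> and \<open>c\<close> with \<open>q\<close>, so \<open>d\<close>,
    \<open>c\<close> take the places of \<open>a\<close>, \<open>b\<close>.\<close>
  moreover have "p' \<cdot> d' = q' \<cdot> c'"
    by (rule inverse_eqI[of e p q d c]) (use e G inv pq pq' in auto)
  ultimately show ?thesis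
    using pq' unfolding Par_def by blast
qed

end

theorem theorem7:
  fixes G :: "'a set" and mult :: "'a \<Rightarrow> 'a \<Rightarrow> 'a"
  assumes "AG_group G mult"
  shows "AG_group (Par_quadruples G mult) (quad_mult mult)"
proof -
  interpret AG_group G mult by fact
  obtain e where e: "e \<in> G" "\<And>x. x \<in> G \<Longrightarrow> mult e x = x"
    and ex: "\<And>a. a \<in> G \<Longrightarrow> \<exists>b\<in>G. mult b a = e \<and> mult a b = e"
    using left_identity_and_inverses by blast
  show ?thesis
  proof
    fix x y z
    assume "x \<in> Par_quadruples G mult" "y \<in> Par_quadruples G mult"
    then show "quad_mult mult x y \<in> Par_quadruples G mult"
      by (auto simp: Par_quadruples_def closed intro: Par_mult)
  next
    fix x y z
    assume "x \<in> Par_quadruples G mult" "y \<in> Par_quadruples G mult" "z \<in> Par_quadruples G mult"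
    then show "quad_mult mult (quad_mult mult x y) z = quad_mult mult (quad_mult mult z y) x"
      by (auto simp: Par_quadruples_def left_invertive)
  next
    let ?e = "(e, e, e, e)"
    \<comment> \<open>Since all four vertices coincide, \<open>p = q = e\<close> serve as
      witnesses.\<close>
    have "?e \<in> Par_quadruples G mult"
      using e by (auto simp: Par_quadruples_def Par_def)
    moreover have "quad_mult mult ?e x = x" if "x \<in> Par_quadruples G mult" for x
      using that e by (auto simp: Par_quadruples_def)
    moreover have "\<exists>y\<in>Par_quadruples G mult. quad_mult mult y x = ?e \<and> quad_mult mult x y = ?e"
      if "x \<in> Par_quadruples G mult" for x
    proof -
      obtain a b c d where x: "x = (a, b, c, d)"
        and G: "a \<in> G" "b \<in> G" "c \<in> G" "d \<in> G" and P: "Par G mult a b c d"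
        using \<open>x \<in> Par_quadruples G mult\<close> unfolding Par_quadruples_def by blast
      obtain a' b' c' d' where G': "a' \<in> G" "b' \<in> G" "c' \<in> G" "d' \<in> G"
        and inv: "mult a' a = e" "mult b' b = e" "mult c' c = e" "mult d' d = e"
          "mult a a' = e" "mult b b' = e" "mult c c' = e" "mult d d' = e"
        using ex G by metis
      \<comment> \<open>Inverses are taken componentwise in \<open>G\<close>; what remains is that
        they again form a parallelogram.\<close>
      have "Par G mult a' b' c' d'"
        using Par_inverse[OF e(2,1) ex G G' inv(1-4) P] by blast
      then show ?thesis
        using G' inv unfolding x
        by (intro bexI[of _ "(a', b', c', d')"]) (auto simp: Par_quadruples_def)
    qed
    ultimately show "\<exists>e\<in>Par_quadruples G mult.
        (\<forall>x\<in>Par_quadruples G mult. quad_mult mult e x = x) \<and>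
        (\<forall>a\<in>Par_quadruples G mult. \<exists>b\<in>Par_quadruples G mult.
          quad_mult mult b a = e \<and> quad_mult mult a b = e)"
      by blast
  qed
qed

end
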